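(* If a Turing degree $\mathbf{a}$ has a strong minimal cover, then $\mathbf{a}$ does not compute any perfect tree all of whose paths are $1$-random.
   Context: A degree $\mathbf{x}$ is a strong minimal cover of $\mathbf{a}$ if $\mathbf{a}<\mathbf{x}$ and every degree strictly below $\mathbf{x}$ is below $\mathbf{a}$. A perfect tree is a map $T:2^{<\omega}\to 2^{<\omega}$ such that for each $\sigma$, the strings $T(\sigma^\frown0)$ and $T(\sigma^\frown1)$ are incompatible and both properly extend $T(\sigma)$; its paths are the sets $T(X)=\bigcup_{\sigma\prec X}T(\sigma)$ for $X\in2^\omega$. "$1$-random" means Martin-Löf random. *)

theory Defs
  imports "HOL-Probability.Probability" "HOL-Library.Sublist"
begin

text \<open>Subsets of \<open>\<nat>\<close> are identified with their characteristic functions, i.e. with the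
  points of Cantor space; finite binary strings are boolean lists, the head being bit 0.\<close>

type_synonym cantor = "nat \<Rightarrow> bool"
type_synonym bitstring = "bool list"

definition initial_segment :: "bitstring \<Rightarrow> cantor \<Rightarrow> bool"
  where "initial_segment \<sigma> X \<longleftrightarrow> \<sigma> = map X [0..<length \<sigma>]"


subsection \<open>Relative computability\<close>

text \<open>Kleene's partial recursive functions relative to an oracle set.\<close>

datatype recf =
    Zero
  | Succ
  | Proj nat
  | Query
  | Comp recf "recf list"
  | PrimRec recf recf
  | Mu recf

text \<open>\<open>eval A e xs y\<close>: program \<open>e\<close> with oracle \<open>A\<close> halts on input \<open>xs\<close> with output \<open>y\<close>.
  In \<open>PrimRec\<close> and \<open>Mu\<close> the recursion variable is the first argument, and minimisation requires
  all earlier values to be defined and nonzero.\<close>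

inductive eval :: "cantor \<Rightarrow> recf \<Rightarrow> nat list \<Rightarrow> nat \<Rightarrow> bool" for A where
  eval_Zero: "eval A Zero xs 0"
| eval_Succ: "eval A Succ [x] (Suc x)"
| eval_Proj: "i < length xs \<Longrightarrow> eval A (Proj i) xs (xs ! i)"
| eval_Query: "eval A Query [x] (of_bool (A x))"
| eval_Comp: "list_all2 (\<lambda>g y. eval A g xs y) gs ys \<Longrightarrow> eval A f ys z
    \<Longrightarrow> eval A (Comp f gs) xs z"
| eval_PrimRec_0: "eval A f xs y \<Longrightarrow> eval A (PrimRec f g) (0 # xs) y"
| eval_PrimRec_Suc: "eval A (PrimRec f g) (n # xs) y \<Longrightarrow> eval A g (n # y # xs) z
    \<Longrightarrow> eval A (PrimRec f g) (Suc n # xs) z"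
| eval_Mu: "eval A f (n # xs) 0 \<Longrightarrow> (\<forall>m<n. \<exists>k. eval A f (m # xs) (Suc k))
    \<Longrightarrow> eval A (Mu f) xs n"
monos list_all2_mono

lemma eval_deterministic: "eval A e xs y \<Longrightarrow> eval A e xs z \<Longrightarrow> y = z"
proof (induction arbitrary: z rule: eval.induct)
  case (eval_Comp xs gs ys f w)
  from eval_Comp.prems obtain ys' where
    ys': "list_all2 (\<lambda>g y. eval A g xs y) gs ys'" "eval A f ys' z"
    by (cases rule: eval.cases) auto
  have "ys = ys'"
    using eval_Comp.IH(1) ys'(1) by (auto simp: list_all2_conv_all_nth intro!: nth_equalityI)
  then show ?case using eval_Comp.IH ys'(2) by blast
next
  case (eval_PrimRec_0 f xs y g)
  from eval_PrimRec_0.prems have "eval A f xs z" by (cases rule: eval.cases) auto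
  then show ?case using eval_PrimRec_0.IH by blast
next
  case (eval_PrimRec_Suc f g n xs y w)
  from eval_PrimRec_Suc.prems obtain y' where
    "eval A (PrimRec f g) (n # xs) y'" "eval A g (n # y' # xs) z"
    by (cases rule: eval.cases) auto
  then show ?case using eval_PrimRec_Suc.IH by blast
next
  case (eval_Mu f n xs)
  from eval_Mu.prems have z: "eval A f (z # xs) 0" "\<forall>m<z. \<exists>k. eval A f (m # xs) (Suc k)"
    by (cases rule: eval.cases, auto)+
  show ?case
  proof (rule linorder_cases[of n z])
    assume "n < z"
    then show ?thesis using z(2) eval_Mu.IH(1) by blast
  next
    assume "z < n"
    then show ?thesis using z(1) eval_Mu.IH(2) by blast
  qed
qed (auto elim: eval.cases)

definition turing_le :: "cantor \<Rightarrow> cantor \<Rightarrow> bool"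
  where "turing_le A B \<longleftrightarrow> (\<exists>e. \<forall>n. eval B e [n] (of_bool (A n)))"

definition turing_equiv :: "cantor \<Rightarrow> cantor \<Rightarrow> bool"
  where "turing_equiv A B \<longleftrightarrow> turing_le A B \<and> turing_le B A"

primrec replace_query :: "recf \<Rightarrow> recf \<Rightarrow> recf" where
  "replace_query q Zero = Zero"
| "replace_query q Succ = Succ"
| "replace_query q (Proj i) = Proj i"
| "replace_query q Query = q"
| "replace_query q (Comp f gs) = Comp (replace_query q f) (map (replace_query q) gs)"
| "replace_query q (PrimRec f g) = PrimRec (replace_query q f) (replace_query q g)"
| "replace_query q (Mu f) = Mu (replace_query q f)"

lemma eval_replace_query:
  assumes "eval A e xs y" and q: "\<And>n. eval B q [n] (of_bool (A n))"
  shows "eval B (replace_query q e) xs y"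
  using assms(1)
proof (induction rule: eval.induct)
  case (eval_Comp xs gs ys f z)
  have "list_all2 (\<lambda>g y. eval B g xs y) (map (replace_query q) gs) ys"
    using eval_Comp.IH(1) by (auto simp: list_all2_conv_all_nth)
  then show ?case using eval_Comp.IH(2) by (auto intro: eval.eval_Comp)
next
  case (eval_Mu f n xs)
  then show ?case by (auto intro!: eval.eval_Mu)
next
  case (eval_Query x)
  show ?case unfolding replace_query.simps by (rule q)
qed (auto intro: eval.intros)

lemma turing_le_refl: "turing_le A A"
  unfolding turing_le_def by (blast intro: eval_Query)

lemma turing_le_trans: "turing_le A B \<Longrightarrow> turing_le B C \<Longrightarrow> turing_le A C"
  unfolding turing_le_def using eval_replace_query by blast

quotient_type turing_degree = "cantor" / turing_equiv
  by (auto intro!: equivpI reflpI sympI transpI simp: turing_equiv_def turing_le_refl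
      intro: turing_le_trans)

instantiation turing_degree :: order
begin

lift_definition less_eq_turing_degree :: "turing_degree \<Rightarrow> turing_degree \<Rightarrow> bool"
  is turing_le
  unfolding turing_equiv_def using turing_le_trans by blast

definition less_turing_degree :: "turing_degree \<Rightarrow> turing_degree \<Rightarrow> bool"
  where "less_turing_degree a b \<longleftrightarrow> a \<le> b \<and> \<not> b \<le> a"

instance
proof
  fix a b c :: turing_degree
  show "a < b \<longleftrightarrow> a \<le> b \<and> \<not> b \<le> a" by (rule less_turing_degree_def)
  show "a \<le> a" by transfer (rule turing_le_refl)
  show "a \<le> b \<Longrightarrow> b \<le> c \<Longrightarrow> a \<le> c" by transfer (rule turing_le_trans)
  show "a \<le> b \<Longrightarrow> b \<le> a \<Longrightarrow> a = b" by transfer (simp add: turing_equiv_def)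
qed

end

definition strong_minimal_cover :: "turing_degree \<Rightarrow> turing_degree \<Rightarrow> bool"
  where "strong_minimal_cover x a \<longleftrightarrow> a < x \<and> (\<forall>b. b < x \<longrightarrow> b \<le> a)"


subsection \<open>Perfect trees\<close>

text \<open>An effective bijection between strings and \<open>\<nat>\<close>: \<open>string_code \<sigma> + 1\<close> has the binary
  expansion consisting of a leading 1 followed by \<open>\<sigma>\<close>, least significant bit first.\<close>

primrec string_code :: "bitstring \<Rightarrow> nat" where
  "string_code [] = 0"
| "string_code (b # \<sigma>) = 2 * string_code \<sigma> + 1 + of_bool b"

definition perfect_tree :: "(bitstring \<Rightarrow> bitstring) \<Rightarrow> bool"
  where "perfect_tree T \<longleftrightarrow>
    (\<forall>\<sigma>. T (\<sigma> @ [False]) \<parallel> T (\<sigma> @ [True]) \<and>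
         strict_prefix (T \<sigma>) (T (\<sigma> @ [False])) \<and> strict_prefix (T \<sigma>) (T (\<sigma> @ [True])))"

text \<open>The union of the strings \<open>T \<sigma>\<close>, \<open>\<sigma> \<prec> X\<close>, as a set of numbers.\<close>

definition tree_path :: "(bitstring \<Rightarrow> bitstring) \<Rightarrow> cantor \<Rightarrow> cantor"
  where "tree_path T X = (\<lambda>n. \<exists>\<sigma>. initial_segment \<sigma> X \<and> n < length (T \<sigma>) \<and> T \<sigma> ! n)"

lift_definition degree_computes :: "turing_degree \<Rightarrow> (bitstring \<Rightarrow> bitstring) \<Rightarrow> bool"
  is "\<lambda>A T. \<exists>e. \<forall>\<sigma>. eval A e [string_code \<sigma>] (string_code (T \<sigma>))"
  unfolding turing_equiv_def turing_le_def using eval_replace_query by blast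


subsection \<open>Martin-Loef randomness\<close>

definition cantor_measure :: "cantor measure"
  where "cantor_measure = PiM UNIV (\<lambda>_. measure_pmf (bernoulli_pmf (1 / 2)))"

text \<open>Computably enumerable sets of pairs are domains of binary partial recursive functions;
  absolute computability is computability with the empty oracle.\<close>

definition ce_pairs :: "(nat \<times> bitstring) set \<Rightarrow> bool"
  where "ce_pairs W \<longleftrightarrow>
    (\<exists>e. \<forall>n \<sigma>. (n, \<sigma>) \<in> W \<longleftrightarrow> (\<exists>y. eval (\<lambda>_. False) e [n, string_code \<sigma>] y))"

definition martin_lof_test :: "(nat \<Rightarrow> cantor set) \<Rightarrow> bool"
  where "martin_lof_test U \<longleftrightarrow>
    (\<exists>W. ce_pairs W \<and> (\<forall>n. U n = {X. \<exists>\<sigma>. (n, \<sigma>) \<in> W \<and> initial_segment \<sigma> X})) \<and>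
    (\<forall>n. emeasure cantor_measure (U n) \<le> ennreal ((1 / 2) ^ n))"

definition martin_lof_random :: "cantor \<Rightarrow> bool"
  where "martin_lof_random X \<longleftrightarrow> (\<forall>U. martin_lof_test U \<longrightarrow> X \<notin> (\<Inter>n. U n))"

end

theory Submission
  imports Defs
begin

text \<open>Let \<open>X\<close> have a degree that is a strong minimal cover of the degree of \<open>A\<close>, and let \<open>T\<close> be a
  perfect tree computable from \<open>A\<close>. The path \<open>R = T(X)\<close> is computable from \<open>X\<close>, and \<open>X\<close> can be
  recovered from \<open>R\<close> and \<open>A\<close>; hence \<open>R\<close> is not computable from \<open>A\<close>, and so it has the degree of \<open>X\<close>.
  If \<open>R\<close> is random, neither of its halves (the even and the odd bits) computes the other: for a fixed
  program \<open>e\<close>, the sets of all \<open>Y\<close> for which \<open>e\<close> computes the first \<open>n\<close> bits of one half from the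
  other half have measure at most \<open>2\<^sup>-\<^sup>n\<close> and form a Martin-Loef test. So both halves have
  degrees strictly below that of \<open>X\<close>, hence are computable from \<open>A\<close>, and then so is \<open>R\<close>, a
  contradiction.\<close>

\<comment> \<open>Inversion rules for evaluation\<close>
inductive_simps eval_Zero_iff: "eval A Zero xs y"
  and eval_Succ_iff: "eval A Succ xs y"
  and eval_Proj_iff: "eval A (Proj i) xs y"
  and eval_Query_iff: "eval A Query xs y"
  and eval_Comp_iff: "eval A (Comp f gs) xs y"
  and eval_PrimRec_Nil_iff: "eval A (PrimRec f g) [] y"
  and eval_PrimRec_0_iff: "eval A (PrimRec f g) (0 # xs) y"
  and eval_PrimRec_Suc_iff: "eval A (PrimRec f g) (Suc n # xs) y"
  and eval_Mu_iff: "eval A (Mu f) xs y"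

lemmas eval_iffs = eval_Zero_iff eval_Succ_iff eval_Proj_iff eval_Query_iff eval_Comp_iff
  eval_PrimRec_Nil_iff eval_PrimRec_0_iff eval_PrimRec_Suc_iff eval_Mu_iff

section \<open>Functions computable from an oracle\<close>

text \<open>With an abstract encoding \<open>enc\<close> of the arguments, strings can be passed around without being
  decoded.\<close>

definition computable_from :: "cantor \<Rightarrow> ('x \<Rightarrow> nat list) \<Rightarrow> ('x \<Rightarrow> nat) \<Rightarrow> bool"
  where "computable_from A enc f \<longleftrightarrow> (\<exists>e. \<forall>x. eval A e (enc x) (f x))"

lemma turing_le_iff_computable:
  "turing_le A B \<longleftrightarrow> computable_from B (\<lambda>n. [n]) (\<lambda>n. of_bool (A n))"
  by (simp add: turing_le_def computable_from_def)

lemma computable_proj: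
  assumes "\<And>x. i < length (enc x)" "\<And>x. enc x ! i = f x"
  shows "computable_from A enc f"
  unfolding computable_from_def using eval_Proj[OF assms(1), of A] assms(2) by auto

lemma computable_arg0: "computable_from A (\<lambda>x. f x # r x) f"
  by (rule computable_proj[of 0]) auto

lemma computable_arg1: "computable_from A (\<lambda>x. a x # f x # r x) f"
  by (rule computable_proj[of 1]) auto

lemma computable_arg2: "computable_from A (\<lambda>x. a x # b x # f x # r x) f"
  by (rule computable_proj[of 2]) auto

lemma computable_arg3: "computable_from A (\<lambda>x. a x # b x # c x # f x # r x) f"
  by (rule computable_proj[of 3]) auto

text \<open>The intermediate value may have any type, since the outer program reads only its code
  \<open>c y\<close>. With \<open>string_code\<close> for \<open>c\<close> this composes maps on
  strings.\<close>

lemma computable_comp: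
  assumes "computable_from A (\<lambda>y. [c y]) g" "computable_from A enc (\<lambda>x. c (h x))"
  shows "computable_from A enc (\<lambda>x. g (h x))"
proof -
  obtain e d where "\<And>y. eval A e [c y] (g y)" "\<And>x. eval A d (enc x) (c (h x))"
    using assms unfolding computable_from_def by blast
  then have "eval A (Comp e [d]) (enc x) (g (h x))" for x
    by (intro eval_Comp[where ys = "[c (h x)]"]) auto
  then show ?thesis unfolding computable_from_def by blast
qed

lemma computable_zero: "computable_from A enc (\<lambda>x. 0)"
  unfolding computable_from_def by (blast intro: eval_Zero)

lemma computable_Suc:
  assumes "computable_from A enc f" shows "computable_from A enc (\<lambda>x. Suc (f x))"
proof -
  have "computable_from A (\<lambda>y. [y]) Suc"
    unfolding computable_from_def by (blast intro: eval_Succ)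
  from computable_comp[OF this assms] show ?thesis .
qed

text \<open>Programs pass parameters on by an explicit list of projections, so the number of
  arguments must not depend on \<open>x\<close>.\<close>

definition fixed_arity :: "('x \<Rightarrow> nat list) \<Rightarrow> bool"
  where "fixed_arity enc \<longleftrightarrow> (\<exists>k. \<forall>x. length (enc x) = k)"

lemma fixed_arity_Nil: "fixed_arity (\<lambda>x. [])"
  by (simp add: fixed_arity_def)

lemma fixed_arity_Cons: "fixed_arity r \<Longrightarrow> fixed_arity (\<lambda>x. f x # r x)"
  by (auto simp: fixed_arity_def)

lemma fixed_arity_comp: "fixed_arity enc \<Longrightarrow> fixed_arity (\<lambda>x. enc (h x))"
  by (auto simp: fixed_arity_def)

text \<open>The recursion values are seen only through their code \<open>c\<close>, so they can be
  strings or truth values. Counter, previous value and parameters are packed into \<open>p\<close>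
  in the argument order of \<open>PrimRec\<close>.\<close>

lemma computable_rec_nat:
  fixes c :: "'y \<Rightarrow> nat"
  assumes "fixed_arity enc"
    and "computable_from A enc (\<lambda>x. c (f x))" "computable_from A enc h"
    and "computable_from A (\<lambda>p. fst p # c (fst (snd p)) # enc (snd (snd p)))
           (\<lambda>p. c (g (fst p) (fst (snd p)) (snd (snd p))))"
  shows "computable_from A enc (\<lambda>x. c (rec_nat (f x) (\<lambda>n y. g n y x) (h x)))"
proof -
  obtain k where k: "\<And>x. length (enc x) = k"
    using assms(1) unfolding fixed_arity_def by blast
  obtain ef eh where f: "\<And>x. eval A ef (enc x) (c (f x))" and h: "\<And>x. eval A eh (enc x) (h x)"
    using assms(2,3) unfolding computable_from_def by blast
  obtain eg where "\<forall>p. eval A eg (fst p # c (fst (snd p)) # enc (snd (snd p)))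
      (c (g (fst p) (fst (snd p)) (snd (snd p))))"
    using assms(4) unfolding computable_from_def by blast
  then have g: "eval A eg (n # c y # enc x) (c (g n y x))" for n y x
    by (metis fst_conv snd_conv)
  have rec: "eval A (PrimRec ef eg) (n # enc x) (c (rec_nat (f x) (\<lambda>n y. g n y x) n))" for n x
    by (induction n) (auto intro: eval.intros f g)
  have "eval A (Comp (PrimRec ef eg) (eh # map Proj [0..<k])) (enc x)
      (c (rec_nat (f x) (\<lambda>n y. g n y x) (h x)))" for x
  proof (rule eval_Comp)
    show "list_all2 (\<lambda>e y. eval A e (enc x) y) (eh # map Proj [0..<k]) (h x # enc x)"
      using h k by (auto simp: list_all2_conv_all_nth nth_Cons intro!: eval_Proj split: nat.split)
  qed (rule rec)
  then show ?thesis unfolding computable_from_def by blast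
qed

lemmas computable_rec_nat_id = computable_rec_nat[where c = "\<lambda>y::nat. y"]

section \<open>Closure under elementary arithmetic and decisions\<close>

lemma computable_const: "computable_from A enc (\<lambda>x. k)"
  by (induction k) (intro computable_zero computable_Suc)+

lemmas computable_basics = computable_const computable_Suc fixed_arity_Cons fixed_arity_Nil
  computable_arg0 computable_arg1 computable_arg2 computable_arg3

lemma computable_add:
  assumes "fixed_arity enc" "computable_from A enc f" "computable_from A enc g"
  shows "computable_from A enc (\<lambda>x. f x + g x)"
proof -
  have "a + b = rec_nat a (\<lambda>n y. Suc y) b" for a b :: nat
    by (induction b) auto
  then show ?thesis
    by (simp only:) (intro computable_rec_nat_id computable_basics
        assms fixed_arity_comp[OF assms(1)])
qed

text \<open>The step of a recursion has two additional leading arguments; this makes functions of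
  the original parameters available there.\<close>

lemma computable_weaken:
  assumes "fixed_arity enc" "computable_from A enc f"
  shows "computable_from A (\<lambda>p. a p # b p # enc (h p)) (\<lambda>p. f (h p))"
proof -
  obtain k where k: "\<And>x. length (enc x) = k"
    using assms(1) unfolding fixed_arity_def by blast
  obtain e where e: "\<And>x. eval A e (enc x) (f x)"
    using assms(2) unfolding computable_from_def by blast
  have "eval A (Comp e (map (\<lambda>i. Proj (i + 2)) [0..<k])) (a p # b p # enc (h p)) (f (h p))" for p
  proof (rule eval_Comp)
    show "list_all2 (\<lambda>g y. eval A g (a p # b p # enc (h p)) y)
        (map (\<lambda>i. Proj (i + 2)) [0..<k]) (enc (h p))"
      using k by (auto simp: list_all2_conv_all_nth eval_Proj_iff)
  qed (rule e)
  then show ?thesis unfolding computable_from_def by blast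
qed

lemma computable_mult:
  assumes "fixed_arity enc" "computable_from A enc f" "computable_from A enc g"
  shows "computable_from A enc (\<lambda>x. f x * g x)"
proof -
  have "a * b = rec_nat 0 (\<lambda>n y. y + a) b" for a b :: nat
    by (induction b) auto
  then show ?thesis
    by (simp only:)
      (intro computable_rec_nat_id computable_add computable_basics computable_weaken[of enc A f]
          assms fixed_arity_comp[OF assms(1)])
qed

lemma computable_pred:
  assumes "fixed_arity enc" "computable_from A enc f"
  shows "computable_from A enc (\<lambda>x. f x - Suc 0)"
proof -
  have "a - Suc 0 = rec_nat 0 (\<lambda>n y. n) a" for a :: nat
    by (cases a) auto
  then show ?thesis
    by (simp only:) (intro computable_rec_nat_id computable_basics
        assms fixed_arity_comp[OF assms(1)])
qed

lemma computable_diff: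
  assumes "fixed_arity enc" "computable_from A enc f" "computable_from A enc g"
  shows "computable_from A enc (\<lambda>x. f x - g x)"
proof -
  have "rec_nat a (\<lambda>n y. y - Suc 0) b = a - b" for a b :: nat
    by (induction b) auto
  moreover have "computable_from A enc (\<lambda>x. rec_nat (f x) (\<lambda>n y. y - Suc 0) (g x))"
    by (intro computable_rec_nat_id computable_pred computable_basics assms
        fixed_arity_comp[OF assms(1)])
  ultimately show ?thesis by simp
qed

lemma computable_not:
  assumes "fixed_arity enc" "computable_from A enc (\<lambda>x. of_bool (P x))"
  shows "computable_from A enc (\<lambda>x. of_bool (\<not> P x))"
proof -
  have "of_bool (\<not> p) = 1 - (of_bool p :: nat)" for p by simp
  then show ?thesis
    by (simp only:) (intro computable_diff computable_basics assms fixed_arity_comp[OF assms(1)])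
qed

lemma computable_eq:
  assumes "fixed_arity enc" "computable_from A enc f" "computable_from A enc g"
  shows "computable_from A enc (\<lambda>x. of_bool (f x = g x))"
proof -
  have "of_bool (a = b) = 1 - ((a - b) + (b - a))" for a b :: nat
    by auto
  then show ?thesis
    by (simp only:) (intro computable_diff computable_add computable_basics
        assms fixed_arity_comp[OF assms(1)])
qed

lemma computable_if:
  assumes "fixed_arity enc" "computable_from A enc (\<lambda>x. of_bool (P x))"
    and "computable_from A enc f" "computable_from A enc g"
  shows "computable_from A enc (\<lambda>x. if P x then f x else g x)"
proof -
  have "(if p then a else b) = of_bool p * a + of_bool (\<not> p) * b" for p and a b :: nat
    by simp
  then show ?thesis
    by (simp only:) (intro computable_add computable_mult computable_not
        assms fixed_arity_comp[OF assms(1)])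
qed

lemma computable_even:
  assumes "fixed_arity enc" "computable_from A enc f"
  shows "computable_from A enc (\<lambda>x. of_bool (even (f x)))"
proof -
  have "even a = rec_nat True (\<lambda>n p. \<not> p) a" for a :: nat
    by (induction a) auto
  then show ?thesis
    by (simp only:)
      (intro computable_rec_nat[where c = of_bool] computable_not computable_basics
          assms fixed_arity_comp[OF assms(1)])
qed

lemma computable_div2:
  assumes "fixed_arity enc" "computable_from A enc f"
  shows "computable_from A enc (\<lambda>x. f x div 2)"
proof -
  have "a div 2 = rec_nat 0 (\<lambda>n y. y + of_bool (\<not> even n)) a" for a :: nat
    by (induction a) auto
  then show ?thesis
    by (simp only:)
      (intro computable_rec_nat_id computable_add computable_not computable_even computable_basics
        assms fixed_arity_comp[OF assms(1)])
qed

lemma computable_power2: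
  assumes "fixed_arity enc" "computable_from A enc f"
  shows "computable_from A enc (\<lambda>x. 2 ^ f x)"
proof -
  have "(2::nat) ^ a = rec_nat 1 (\<lambda>n y. y + y) a" for a :: nat
    by (induction a) auto
  then show ?thesis
    by (simp only:) (intro computable_rec_nat_id computable_add computable_basics
        assms fixed_arity_comp[OF assms(1)])
qed

lemmas computable_arith = computable_basics computable_add computable_mult computable_diff
  computable_not computable_eq computable_if computable_even computable_div2 computable_power2


section \<open>Operations on strings\<close>

text \<open>The code is bijective base 2 with digits 1 and 2, so the parity of a nonzero code
  determines the head. Strings can therefore be compared through their codes.\<close>

lemma inj_string_code: "string_code \<sigma> = string_code \<tau> \<Longrightarrow> \<sigma> = \<tau>"
proof (induction \<sigma> arbitrary: \<tau>)
  case Nil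
  then show ?case by (cases \<tau>) auto
next
  case (Cons b \<sigma>)
  then show ?case
  proof (cases \<tau>)
    case (Cons c \<rho>)
    with Cons.prems have *: "2 * string_code \<sigma> + of_bool b = 2 * string_code \<rho> + of_bool c"
      by simp
    then have "b = c" by (cases b; cases c) (simp_all, presburger+)
    with * Cons Cons.IH show ?thesis by simp
  qed simp
qed

text \<open>Truncated subtraction makes this correct for the empty string as well, whose tail is
  again empty.\<close>

lemma string_code_tl: "string_code (tl \<sigma>) = (string_code \<sigma> - 1) div 2"
  by (cases \<sigma>) auto

lemma string_code_snoc: "string_code (\<sigma> @ [b]) = string_code \<sigma> + 2 ^ length \<sigma> * Suc (of_bool b)"
  by (induction \<sigma>) (auto simp: algebra_simps)

lemma length_le_string_code: "length \<sigma> \<le> string_code \<sigma>"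
  by (induction \<sigma>) auto

lemma string_code_eq_0_iff: "string_code \<sigma> = 0 \<longleftrightarrow> \<sigma> = []"
  by (cases \<sigma>) auto

lemma computable_drop:
  assumes "fixed_arity enc" "computable_from A enc (\<lambda>x. string_code (s x))"
    and "computable_from A enc f"
  shows "computable_from A enc (\<lambda>x. string_code (drop (f x) (s x)))"
proof -
  have "drop i \<sigma> = rec_nat \<sigma> (\<lambda>n \<tau>. tl \<tau>) i" for i and \<sigma> :: bitstring
    by (induction i) (simp_all add: drop_Suc flip: tl_drop)
  then show ?thesis
    by (simp only:)
      (intro computable_rec_nat[where c = string_code] computable_arith
          assms fixed_arity_comp[OF assms(1)],
        simp only: string_code_tl,
        intro computable_arith fixed_arity_comp[OF assms(1)])
qed

lemma computable_less_length:
  assumes "fixed_arity enc" "computable_from A enc (\<lambda>x. string_code (s x))"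
    and "computable_from A enc f"
  shows "computable_from A enc (\<lambda>x. of_bool (f x < length (s x)))"
proof -
  have "i < length \<sigma> \<longleftrightarrow> \<not> string_code (drop i \<sigma>) = 0" for i and \<sigma> :: bitstring
    by (simp add: string_code_eq_0_iff not_le)
  then show ?thesis
    by (simp only:) (intro computable_drop computable_arith assms fixed_arity_comp[OF assms(1)])
qed

lemma computable_length:
  assumes "fixed_arity enc" "computable_from A enc (\<lambda>x. string_code (s x))"
  shows "computable_from A enc (\<lambda>x. length (s x))"
proof -
  \<comment> \<open>Counting the n below the code with \<open>n < length \<sigma>\<close> gives the
    length, because the code is at least as large as the length.\<close>
  have "rec_nat 0 (\<lambda>n y. y + of_bool (n < length \<sigma>)) m = min m (length \<sigma>)"
    for m and \<sigma> :: bitstring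
    by (induction m) auto
  then have length_eq: "length \<sigma> = rec_nat 0 (\<lambda>n y. y + of_bool (n < length \<sigma>)) (string_code \<sigma>)"
    for \<sigma> :: bitstring
    using length_le_string_code[of \<sigma>] by (simp add: min_def)
  have "computable_from A enc
      (\<lambda>x. rec_nat 0 (\<lambda>n y. y + of_bool (n < length (s x))) (string_code (s x)))"
    by (intro computable_rec_nat_id computable_less_length computable_arith
        computable_weaken[of enc A "\<lambda>x. string_code (s x)"] assms fixed_arity_comp[OF assms(1)])
  then show ?thesis unfolding length_eq[symmetric] .
qed

text \<open>The value 0 marks a position beyond the end. A search for z with
  \<open>bit_or_0 \<sigma> i = Suc z\<close> then finds the bit or diverges, which is how the
  simulation answers queries.\<close>

definition bit_or_0 :: "bitstring \<Rightarrow> nat \<Rightarrow> nat"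
  where "bit_or_0 \<sigma> i = (if i < length \<sigma> then Suc (of_bool (\<sigma> ! i)) else 0)"

lemma computable_bit_or_0:
  assumes "fixed_arity enc" "computable_from A enc (\<lambda>x. string_code (s x))"
    and "computable_from A enc f"
  shows "computable_from A enc (\<lambda>x. bit_or_0 (s x) (f x))"
proof -
  \<comment> \<open>A head \<open>True\<close> contributes the digit 2 and \<open>False\<close> the
    digit 1, so the code of a nonempty string is even exactly when it begins with
    \<open>True\<close>.\<close>
  have "even (string_code (drop i \<sigma>)) = \<sigma> ! i" if "i < length \<sigma>" for i and \<sigma> :: bitstring
    using that by (simp flip: Cons_nth_drop_Suc)
  then have "bit_or_0 \<sigma> i =
      (if i < length \<sigma> then Suc (of_bool (even (string_code (drop i \<sigma>)))) else 0)"
    for i and \<sigma> :: bitstring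
    by (simp add: bit_or_0_def)
  then show ?thesis
    by (simp only:) (intro computable_drop computable_less_length computable_arith
        assms fixed_arity_comp[OF assms(1)])
qed

lemma computable_snoc:
  assumes "fixed_arity enc" "computable_from A enc (\<lambda>x. string_code (s x))"
    and "computable_from A enc (\<lambda>x. of_bool (P x))"
  shows "computable_from A enc (\<lambda>x. string_code (s x @ [P x]))"
  unfolding string_code_snoc by (intro computable_length computable_arith
      assms fixed_arity_comp[OF assms(1)])

lemma computable_map_upt:
  assumes "fixed_arity enc" "computable_from A (\<lambda>n. [n]) (\<lambda>n. of_bool (X n))"
    and "computable_from A enc f"
  shows "computable_from A enc (\<lambda>x. string_code (map X [0..<f x]))"
proof -
  have "map X [0..<m] = rec_nat [] (\<lambda>n \<sigma>. \<sigma> @ [X n]) m" for m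
    by (induction m) auto
  then show ?thesis
    by (simp only:)
      (intro computable_rec_nat[where c = string_code] computable_snoc
        computable_comp[OF assms(2)] computable_arith assms fixed_arity_comp[OF assms(1)])
qed

lemma computable_initial_segment:
  assumes "fixed_arity enc" "computable_from A (\<lambda>n. [n]) (\<lambda>n. of_bool (X n))"
    and "computable_from A enc (\<lambda>x. string_code (s x))"
  shows "computable_from A enc (\<lambda>x. of_bool (initial_segment (s x) X))"
proof -
  have "initial_segment \<sigma> X \<longleftrightarrow> string_code \<sigma> = string_code (map X [0..<length \<sigma>])" for \<sigma>
    unfolding initial_segment_def using inj_string_code by metis
  then show ?thesis
    by (simp only:) (intro computable_map_upt computable_length computable_arith
        assms fixed_arity_comp[OF assms(1)])
qed


section \<open>Paths through perfect trees\<close>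

lemma initial_segment_iff: "initial_segment \<sigma> X \<longleftrightarrow> (\<forall>i<length \<sigma>. \<sigma> ! i = X i)"
  unfolding initial_segment_def by (subst list_eq_iff_nth_eq) simp

lemma initial_segment_map: "initial_segment (map X [0..<m]) X"
  by (simp add: initial_segment_def)

lemma initial_segments_not_parallel:
  assumes "initial_segment \<sigma> X" "initial_segment \<tau> X"
  shows "\<not> \<sigma> \<parallel> \<tau>"
proof -
  have "prefix \<sigma> \<tau>" if "length \<sigma> \<le> length \<tau>" "initial_segment \<sigma> X" "initial_segment \<tau> X" for \<sigma> \<tau>
    using that initial_segment_iff by (metis (no_types, lifting) initial_segment_def
        map_mono_prefix prefix_def upt_add_eq_append le_add_diff_inverse zero_le)
  from this[of \<sigma> \<tau>] this[of \<tau> \<sigma>] assms show ?thesis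
    unfolding parallel_def by linarith
qed

context
  fixes T :: "bitstring \<Rightarrow> bitstring"
  assumes perfect: "perfect_tree T"
begin

lemma perfect_tree_strict_prefix: "strict_prefix (T \<sigma>) (T (\<sigma> @ [b]))"
  using perfect by (cases b) (auto simp: perfect_tree_def)

text \<open>Each level adds at least one bit; hence bit n of a path is already visible at level n +
  1.\<close>

lemma perfect_tree_length: "length \<sigma> \<le> length (T \<sigma>)"
proof (induction \<sigma> rule: rev_induct)
  case (snoc b \<sigma>)
  then show ?case
    using prefix_length_less[OF perfect_tree_strict_prefix[of \<sigma> b]] by simp
qed simp

lemma perfect_tree_prefix_chain:
  assumes "m \<le> n" shows "prefix (T (map X [0..<m])) (T (map X [0..<n]))"
  using assms
proof (induction n rule: dec_induct)
  case (step n)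
  have "prefix (T (map X [0..<n])) (T (map X [0..<Suc n]))"
    using perfect_tree_strict_prefix[of "map X [0..<n]" "X n"] by (simp add: strict_prefix_def)
  with step.IH show ?case by (rule prefix_order.trans)
qed simp

text \<open>The nodes along \<open>X\<close> form a chain, so all that reach position i agree there,
  and the existential in \<open>tree_path\<close> reads off an unambiguous bit.\<close>

lemma initial_segment_tree_path: "initial_segment (T (map X [0..<m])) (tree_path T X)"
  unfolding initial_segment_iff
proof (intro allI impI)
  fix i assume i: "i < length (T (map X [0..<m]))"
  have "T \<sigma> ! i = T (map X [0..<m]) ! i" if "initial_segment \<sigma> X" "i < length (T \<sigma>)" for \<sigma>
  proof -
    from that have \<sigma>: "\<sigma> = map X [0..<length \<sigma>]" by (simp add: initial_segment_def)
    have "prefix (T \<sigma>) (T (map X [0..<m])) \<or> prefix (T (map X [0..<m])) (T \<sigma>)"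
      using perfect_tree_prefix_chain[of m "length \<sigma>" X] perfect_tree_prefix_chain[of "length \<sigma>" m X]
      by (metis \<sigma> linear)
    then show ?thesis using i that(2) by (auto simp: prefix_def nth_append)
  qed
  then show "T (map X [0..<m]) ! i = tree_path T X i"
    unfolding tree_path_def using i initial_segment_map by blast
qed

text \<open>The two children of a node are incompatible, so the path extends only the one that
  \<open>X\<close> selects. This allows \<open>X\<close> to be decoded from its path bit by
  bit.\<close>

lemma branch_iff_initial_segment:
  "X n \<longleftrightarrow> initial_segment (T (map X [0..<n] @ [True])) (tree_path T X)"
proof (cases "X n")
  case True
  then show ?thesis using initial_segment_tree_path[of X "Suc n"] by simp
next
  case False
  then have "initial_segment (T (map X [0..<n] @ [False])) (tree_path T X)"
    using initial_segment_tree_path[of X "Suc n"] by simp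
  then have "\<not> initial_segment (T (map X [0..<n] @ [True])) (tree_path T X)"
    using initial_segments_not_parallel perfect unfolding perfect_tree_def by blast
  with False show ?thesis by simp
qed

lemma tree_path_le:
  assumes "computable_from B (\<lambda>\<sigma>. [string_code \<sigma>]) (\<lambda>\<sigma>. string_code (T \<sigma>))" "turing_le X B"
  shows "turing_le (tree_path T X) B"
proof -
  \<comment> \<open>Level \<open>Suc n\<close> has length at least n + 1, so position n exists; the
    subtraction undoes the shift in \<open>bit_or_0\<close>.\<close>
  have bit: "of_bool (tree_path T X n) = bit_or_0 (T (map X [0..<Suc n])) n - 1" for n
  proof -
    have "n < length (T (map X [0..<Suc n]))"
      using perfect_tree_length[of "map X [0..<Suc n]"] by simp
    then show ?thesis
      using initial_segment_tree_path[of X "Suc n"] by (auto simp: initial_segment_iff bit_or_0_def)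
  qed
  note T = computable_comp[OF assms(1)]
  note X = assms(2)[unfolded turing_le_iff_computable]
  show ?thesis
    unfolding turing_le_iff_computable bit
    by (intro computable_bit_or_0 T computable_map_upt X computable_arith)
qed

lemma le_tree_path:
  assumes "computable_from B (\<lambda>\<sigma>. [string_code \<sigma>]) (\<lambda>\<sigma>. string_code (T \<sigma>))"
    and "turing_le (tree_path T X) B"
  shows "turing_le X B"
proof -
  let ?R = "tree_path T X"
  \<comment> \<open>Decodes \<open>X\<close> by asking at each node whether the \<open>True\<close>
    child lies on the path; \<open>X\<close> enters only through the oracle for
    \<open>?R\<close>.\<close>
  let ?prefix = "rec_nat [] (\<lambda>n \<sigma>. \<sigma> @ [initial_segment (T (\<sigma> @ [True])) ?R])"
  have "?prefix m = map X [0..<m]" for m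
    by (induction m) (simp_all flip: branch_iff_initial_segment[of X])
  then have X_eq: "(\<lambda>n. of_bool (initial_segment (T (?prefix n @ [True])) ?R))
      = (\<lambda>n. of_bool (X n) :: nat)"
    by (simp flip: branch_iff_initial_segment[of X])
  note T = computable_comp[OF assms(1)]
  note R = assms(2)[unfolded turing_le_iff_computable]
  have "computable_from B (\<lambda>n. [n]) (\<lambda>n. of_bool (initial_segment (T (?prefix n @ [True])) ?R))"
    by (intro computable_initial_segment R T computable_snoc
        computable_rec_nat[where c = string_code] computable_arith)
  then show ?thesis unfolding turing_le_iff_computable X_eq .
qed

end

lemma turing_le_even_odd:
  assumes "turing_le (\<lambda>n. R (2 * n)) A" "turing_le (\<lambda>n. R (2 * n + 1)) A"
  shows "turing_le R A"
proof -
  have "computable_from A (\<lambda>n. [n])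
      (\<lambda>n. if even n then of_bool (R (2 * (n div 2))) else of_bool (R (2 * (n div 2) + 1)))"
    by (intro assms[unfolded turing_le_iff_computable, THEN computable_comp] computable_arith)
  moreover have "(\<lambda>n. if even n then of_bool (R (2 * (n div 2))) else of_bool (R (2 * (n div 2) + 1)))
      = (\<lambda>n. of_bool (R n) :: nat)"
    by auto
  ultimately show ?thesis unfolding turing_le_iff_computable by (simp only:)
qed


section \<open>Simulating an oracle by a finite string\<close>

lemma not_eval_Mu_Succ: "\<not> eval A (Mu Succ) xs y"
  by (simp add: eval_Mu_iff eval_Succ_iff)

text \<open>\<open>simulate q e k\<close> runs \<open>e\<close> on the first \<open>k\<close> arguments, passing an additional last argument \<open>s\<close>
  down to the program \<open>q\<close>, which answers the queries. The arity \<open>k\<close> is needed to locate \<open>s\<close>;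
  \<open>Mu Succ\<close> is a program that never halts, for arities that \<open>e\<close> does not accept.\<close>

primrec simulate :: "recf \<Rightarrow> recf \<Rightarrow> nat \<Rightarrow> recf" where
  "simulate q Zero = (\<lambda>k. Zero)"
| "simulate q Succ = (\<lambda>k. if k = 1 then Comp Succ [Proj 0] else Mu Succ)"
| "simulate q (Proj i) = (\<lambda>k. if i < k then Proj i else Mu Succ)"
| "simulate q Query = (\<lambda>k. if k = 1 then q else Mu Succ)"
| "simulate q (Comp f gs) = (\<lambda>k. Comp (simulate q f (length gs))
      (map (\<lambda>h. h k) (map (simulate q) gs) @ [Proj k]))"
| "simulate q (PrimRec f g) = (\<lambda>k. if k = 0 then Mu Succ
      else PrimRec (simulate q f (k - 1)) (simulate q g (k + 1)))"
| "simulate q (Mu f) = (\<lambda>k. Mu (simulate q f (k + 1)))"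

text \<open>The program \<open>q\<close> may diverge but must be right when it halts: a halting
  simulation has received an answer to every query it made.\<close>

lemma simulate_sound:
  assumes q: "\<And>n z. eval C q [n, s] z \<Longrightarrow> z = of_bool (B n)"
  shows "eval C (simulate q e (length xs)) (xs @ [s]) y \<Longrightarrow> eval B e xs y"
proof (induction e arbitrary: xs y)
  case Zero
  then show ?case by (simp add: eval_Zero_iff)
next
  case Succ
  then show ?case
    by (cases xs) (auto simp: eval_iffs not_eval_Mu_Succ list_all2_Cons1 split: if_splits)
next
  case (Proj i)
  then show ?case by (auto simp: eval_iffs not_eval_Mu_Succ nth_append split: if_splits)
next
  case Query
  then obtain n where "xs = [n]"
    by (auto simp: not_eval_Mu_Succ length_Suc_conv split: if_splits)
  with Query q[of n y] show ?case by (simp add: eval_Query_iff)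
next
  case (Comp f gs)
  from Comp.prems obtain zs where zs:
    "list_all2 (\<lambda>g z. eval C g (xs @ [s]) z)
      (map (\<lambda>g. simulate q g (length xs)) gs @ [Proj (length xs)]) zs"
    "eval C (simulate q f (length gs)) zs y"
    by (auto simp: eval_Comp_iff comp_def)
  \<comment> \<open>The entry \<open>Proj (length xs)\<close> evaluates to \<open>s\<close>, so the
    simulated \<open>f\<close> again receives \<open>s\<close> as its last argument.\<close>
  then obtain ys where ys: "zs = ys @ [s]"
    "list_all2 (\<lambda>g z. eval C g (xs @ [s]) z) (map (\<lambda>g. simulate q g (length xs)) gs) ys"
    by (auto simp: list_all2_append1 list_all2_Cons1 eval_Proj_iff)
  have "length ys = length gs" using list_all2_lengthD[OF ys(2)] by simp
  then have "eval B f ys y" using Comp.IH(1)[of ys y] zs(2) ys(1) by simp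
  moreover have "list_all2 (\<lambda>g z. eval B g xs z) gs ys"
    using ys(2) Comp.IH(2) by (auto simp: list_all2_conv_all_nth)
  ultimately show ?case by (auto intro: eval_Comp)
next
  case (PrimRec f g)
  then obtain n zs where xs: "xs = n # zs" by (cases xs) (auto simp: not_eval_Mu_Succ)
  \<comment> \<open>The arity of \<open>xs\<close> is \<open>length zs + 1\<close>; the step program
    sees counter and previous value in front of \<open>zs\<close>, hence
    \<open>length zs + 2\<close>.\<close>
  have "eval C (PrimRec (simulate q f (length zs)) (simulate q g (length zs + 2))) (n # zs @ [s]) y
      \<Longrightarrow> eval B (PrimRec f g) (n # zs) y" for y
  proof (induction n arbitrary: y)
    case 0
    then show ?case using PrimRec.IH(1)[of zs y] by (auto simp: eval_PrimRec_0_iff)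
  next
    case (Suc n)
    then obtain z where z: "eval C (simulate q g (length zs + 2)) (n # z # zs @ [s]) y"
      "eval B (PrimRec f g) (n # zs) z"
      by (auto simp: eval_PrimRec_Suc_iff)
    then show ?case using PrimRec.IH(2)[of "n # z # zs" y] by (auto simp: eval_PrimRec_Suc_iff)
  qed
  with PrimRec.prems xs show ?case by simp
next
  case (Mu f)
  have "eval B f (n # xs) z" if "eval C (simulate q f (Suc (length xs))) (n # xs @ [s]) z" for n z
    using Mu.IH[of "n # xs" z] that by simp
  with Mu.prems show ?case by (simp add: eval_Mu_iff) blast
qed

text \<open>A halting computation makes finitely many queries. Each is answered eventually along the
  filter, and finitely many eventual conditions eventually hold together.\<close>

lemma simulate_complete:
  assumes q: "\<And>n. \<forall>\<^sub>F l in F. eval C q [n, s l] (of_bool (B n))"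
  shows "eval B e xs y \<Longrightarrow> \<forall>\<^sub>F l in F. eval C (simulate q e (length xs)) (xs @ [s l]) y"
proof (induction rule: eval.induct)
  case (eval_Query x)
  then show ?case using q[of x] by simp
next
  case (eval_Comp xs gs ys f z)
  have len: "length gs = length ys" using eval_Comp.IH(1) by (rule list_all2_lengthD)
  have "\<forall>\<^sub>F l in F. \<forall>i\<in>{..<length gs}. eval C (simulate q (gs ! i) (length xs)) (xs @ [s l]) (ys ! i)"
    using eval_Comp.IH(1) by (intro eventually_ball_finite) (auto simp: list_all2_conv_all_nth)
  with eval_Comp.IH(2) show ?case
  proof eventually_elim
    case (elim l)
    show ?case unfolding simulate.simps
    proof (rule eval.eval_Comp)
      show "list_all2 (\<lambda>g z. eval C g (xs @ [s l]) z)
          (map (\<lambda>h. h (length xs)) (map (simulate q) gs) @ [Proj (length xs)]) (ys @ [s l])"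
        using elim(2) len
        by (intro list_all2_appendI) (auto simp: list_all2_conv_all_nth eval_Proj_iff)
    qed (use elim(1) len in simp)
  qed
next
  case (eval_PrimRec_0 f xs y g)
  then show ?case by (simp add: eval_PrimRec_0_iff)
next
  case (eval_PrimRec_Suc f g n xs y z)
  from eval_PrimRec_Suc.IH show ?case
    by eventually_elim (auto simp: eval_PrimRec_Suc_iff)
next
  case (eval_Mu f n xs)
  \<comment> \<open>Fixing the earlier values \<open>Suc (c m)\<close> independently of l leaves
    finitely many conditions, one for each m < n.\<close>
  from eval_Mu.IH(2) obtain c
    where c: "\<And>m. m < n \<Longrightarrow> \<forall>\<^sub>F l in F. eval C (simulate q f (length (m # xs))) ((m # xs) @ [s l]) (Suc (c m))"
    by metis
  have "\<forall>\<^sub>F l in F. \<forall>m\<in>{..<n}. eval C (simulate q f (length (m # xs))) ((m # xs) @ [s l]) (Suc (c m))"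
    using c by (intro eventually_ball_finite) simp_all
  with eval_Mu.IH(1) show ?case
    by eventually_elim (auto simp: eval_Mu_iff)
qed (auto simp: eval_iffs nth_append list_all2_Cons1 intro!: always_eventually)


section \<open>The fair coin measure\<close>

lemma space_cantor_measure: "space cantor_measure = UNIV"
  by (simp add: cantor_measure_def space_PiM)

lemma coordinate_measurable: "(\<lambda>Y. Y i) \<in> measurable cantor_measure (count_space UNIV)"
  unfolding cantor_measure_def by measurable

lemma sets_initial_segment: "{Y. initial_segment \<sigma> Y} \<in> sets cantor_measure"
proof -
  have "{Y \<in> space cantor_measure. \<forall>i\<in>{..<length \<sigma>}. \<sigma> ! i = Y i} \<in> sets cantor_measure"
    using coordinate_measurable by measurable
  then show ?thesis by (simp add: initial_segment_iff space_cantor_measure Ball_def)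
qed

text \<open>The measure-preserving symmetry behind the factor 1/2 gained at each level of the
  test.\<close>

definition flip_bit :: "nat \<Rightarrow> cantor \<Rightarrow> cantor"
  where "flip_bit j Y = Y(j := \<not> Y j)"

lemma flip_bit_measurable: "flip_bit j \<in> measurable cantor_measure cantor_measure"
proof -
  have "(\<lambda>Y i. if i = j then \<not> Y i else Y i) \<in> measurable cantor_measure cantor_measure"
    unfolding cantor_measure_def by (rule measurable_PiM_single') (auto simp: space_PiM)
  moreover have "flip_bit j = (\<lambda>Y i. if i = j then \<not> Y i else Y i)"
    by (auto simp: flip_bit_def fun_eq_iff)
  ultimately show ?thesis by simp
qed

text \<open>Finite cylinders determine the product measure. Flipping changes only their side at
  \<open>j\<close>, and negation preserves a fair coin.\<close>

lemma distr_flip_bit: "distr cantor_measure cantor_measure (flip_bit j) = cantor_measure"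
proof -
  let ?M = "\<lambda>_::nat. measure_pmf (bernoulli_pmf (1 / 2))"
  interpret product_prob_space ?M UNIV
    by standard
  let ?D = "distr cantor_measure cantor_measure (flip_bit j)"
  have "PiM UNIV ?M = ?D"
  proof (rule measure_eqI_PiM_infinite[OF refl])
    show "sets ?D = sets (PiM UNIV ?M)" by (simp add: cantor_measure_def)
    show "finite_measure (PiM UNIV ?M)" by (rule P.finite_measure_axioms)
    fix J :: "nat set" and E :: "nat \<Rightarrow> bool set"
    assume J: "finite J"
    let ?E' = "\<lambda>i. if i = j then Not -` E i else E i"
    have emb: "prod_emb UNIV ?M J (Pi\<^sub>E J E) = {Y. \<forall>i\<in>J. Y i \<in> E i}" for E
      by (auto simp: prod_emb_def Pi_iff)
    have half: "emeasure (?M i) (Not -` S) = emeasure (?M i) S" for i :: nat and S :: "bool set"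
    proof -
      have "map_pmf Not (bernoulli_pmf (1 / 2)) = bernoulli_pmf (1 / 2)"
        proof (rule pmf_eqI)
        fix b show "pmf (map_pmf Not (bernoulli_pmf (1 / 2))) b = pmf (bernoulli_pmf (1 / 2)) b"
          using pmf_map_inj'[of Not "bernoulli_pmf (1 / 2)" "\<not> b"] by (cases b) (simp_all add: inj_def)
      qed
      then show ?thesis by (metis emeasure_map_pmf)
    qed
    have "emeasure ?D (prod_emb UNIV ?M J (Pi\<^sub>E J E))
        = emeasure (PiM UNIV ?M) (prod_emb UNIV ?M J (Pi\<^sub>E J ?E'))"
    proof -
      have "prod_emb UNIV ?M J (Pi\<^sub>E J E) \<in> sets cantor_measure"
        unfolding cantor_measure_def using J by (intro sets_PiM_I) auto
      then have "emeasure ?D (prod_emb UNIV ?M J (Pi\<^sub>E J E))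
          = emeasure cantor_measure (flip_bit j -` prod_emb UNIV ?M J (Pi\<^sub>E J E))"
        by (simp add: emeasure_distr[OF flip_bit_measurable] space_cantor_measure)
      also have "flip_bit j -` prod_emb UNIV ?M J (Pi\<^sub>E J E) = prod_emb UNIV ?M J (Pi\<^sub>E J ?E')"
        unfolding emb by (auto simp: flip_bit_def)
      finally show ?thesis by (simp add: cantor_measure_def)
    qed
    also have "\<dots> = (\<Prod>i\<in>J. emeasure (?M i) (?E' i))"
      using J by (intro emeasure_PiM_emb) auto
    also have "\<dots> = (\<Prod>i\<in>J. emeasure (?M i) (E i))"
      by (intro prod.cong) (auto simp: half)
    also have "\<dots> = emeasure (PiM UNIV ?M) (prod_emb UNIV ?M J (Pi\<^sub>E J E))"
      using J by (intro emeasure_PiM_emb[symmetric]) auto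
    finally show "emeasure (PiM UNIV ?M) (prod_emb UNIV ?M J (Pi\<^sub>E J E))
        = emeasure ?D (prod_emb UNIV ?M J (Pi\<^sub>E J E))" ..
  qed
  then show ?thesis by (simp add: cantor_measure_def)
qed

text \<open>\<open>S\<close> and its preimage under the flip have the same measure and fit
  disjointly into \<open>S'\<close>.\<close>

lemma emeasure_le_half_if_flip_disjoint:
  assumes "S \<in> sets cantor_measure" "S' \<in> sets cantor_measure"
    and "S \<subseteq> S'" "flip_bit j -` S \<subseteq> S'" "S \<inter> flip_bit j -` S = {}"
  shows "2 * emeasure cantor_measure S \<le> emeasure cantor_measure S'"
proof -
  let ?F = "flip_bit j -` S"
  have F: "?F \<in> sets cantor_measure"
    using measurable_sets[OF flip_bit_measurable assms(1)] by (simp add: space_cantor_measure)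
  have "emeasure cantor_measure S = emeasure (distr cantor_measure cantor_measure (flip_bit j)) S"
    by (simp add: distr_flip_bit)
  also have "\<dots> = emeasure cantor_measure ?F"
    using assms(1) by (simp add: emeasure_distr[OF flip_bit_measurable] space_cantor_measure)
  finally have "2 * emeasure cantor_measure S = emeasure cantor_measure S + emeasure cantor_measure ?F"
    by (simp add: mult_2)
  also have "\<dots> = emeasure cantor_measure (S \<union> ?F)"
    using assms F by (intro plus_emeasure) auto
  also have "\<dots> \<le> emeasure cantor_measure S'"
    using assms by (intro emeasure_mono) auto
  finally show ?thesis .
qed


section \<open>Disjoint parts of a random set do not compute each other\<close>

text \<open>For a fixed program these are the levels of the Martin-Loef test. Keeping
  \<open>p\<close> and \<open>q\<close> arbitrary covers even bits from odd bits and
  conversely.\<close>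

definition correct_upto :: "(nat \<Rightarrow> nat) \<Rightarrow> (nat \<Rightarrow> nat) \<Rightarrow> recf \<Rightarrow> nat \<Rightarrow> cantor set"
  where "correct_upto p q e n = {Y. \<forall>k<n. eval (\<lambda>i. Y (p i)) e [k] (of_bool (Y (q k)))}"

text \<open>No step counting is needed: a query beyond the end of the string makes the simulation diverge,
  and only the domain of the resulting program matters.\<close>

lemma correct_upto_ce:
  assumes p: "computable_from (\<lambda>_. False) (\<lambda>n. [n]) p"
    and q: "computable_from (\<lambda>_. False) (\<lambda>n. [n]) q"
  shows "\<exists>W. ce_pairs W \<and>
    (\<forall>n. correct_upto p q e n = {Y. \<exists>\<sigma>. (n, \<sigma>) \<in> W \<and> initial_segment \<sigma> Y})"
proof -
  let ?N = "\<lambda>_::nat. False"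
  have Mu_iff: "eval ?N (Mu d) xs z \<longleftrightarrow> D z = 0 \<and> (\<forall>m<z. D m \<noteq> 0)"
    if "\<And>m. eval ?N d (m # xs) (D m)" for d xs z and D :: "nat \<Rightarrow> nat"
    unfolding eval_Mu_iff using that eval_deterministic[OF that] by (metis not0_implies_Suc nat.distinct(1))
  note arith = computable_bit_or_0 computable_comp[OF p] computable_comp[OF q] computable_arith
  have "computable_from ?N (\<lambda>x. [fst x, fst (snd x), string_code (snd (snd x))])
      (\<lambda>x. of_bool (\<not> bit_or_0 (snd (snd x)) (p (fst (snd x))) = Suc (fst x)))"
    by (intro arith)
  then obtain dp where dp: "eval ?N dp [m, i, string_code \<sigma>] (of_bool (\<not> bit_or_0 \<sigma> (p i) = Suc m))"
    for m i \<sigma>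
    unfolding computable_from_def by (metis fst_conv snd_conv)
  have "computable_from ?N (\<lambda>x. [fst x, fst (snd x), fst (snd (snd x)), string_code (snd (snd (snd x)))])
      (\<lambda>x. of_bool (\<not> bit_or_0 (snd (snd (snd x))) (q (fst (snd (snd x)))) = Suc (fst (snd x))))"
    by (intro arith)
  then obtain dq where dq: "eval ?N dq [m, v, k, string_code \<sigma>] (of_bool (\<not> bit_or_0 \<sigma> (q k) = Suc v))"
    for m v k \<sigma>
    unfolding computable_from_def by (metis fst_conv snd_conv)
  \<comment> \<open>\<open>Mu dp\<close> searches for the bit of \<open>\<sigma>\<close> at
    \<open>p i\<close>; beyond the end no z matches and it diverges.\<close>
  have query: "eval ?N (Mu dp) [i, string_code \<sigma>] z \<longleftrightarrow> bit_or_0 \<sigma> (p i) = Suc z" for i \<sigma> z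
    by (subst Mu_iff[OF dp]) auto
  \<comment> \<open>\<open>dq\<close> gives the same value for all m, so the search stops at 0 or
    never: a decidable comparison becomes a halting condition.\<close>
  have check: "eval ?N (Mu dq) [v, k, string_code \<sigma>] z \<longleftrightarrow> z = 0 \<and> bit_or_0 \<sigma> (q k) = Suc v"
    for v k \<sigma> z
    by (subst Mu_iff[OF dq]) auto
  define sim where "sim = simulate (Mu dp) e 1"
  \<comment> \<open>Within \<open>PrimRec\<close> the arguments are k, the previous value and the
    string; projection 1 is skipped. The recursion halts iff all steps k < n do, which expresses the
    bounded quantifier in \<open>W\<close>.\<close>
  define step where "step = Comp (Mu dq) [Comp sim [Proj 0, Proj 2], Proj 0, Proj 2]"
  define W where "W = {(n, \<sigma>). \<forall>k<n. \<exists>v. eval ?N sim [k, string_code \<sigma>] v \<and> bit_or_0 \<sigma> (q k) = Suc v}"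
  have step: "eval ?N step [k, y, string_code \<sigma>] z \<longleftrightarrow>
      z = 0 \<and> (\<exists>v. eval ?N sim [k, string_code \<sigma>] v \<and> bit_or_0 \<sigma> (q k) = Suc v)" for k y \<sigma> z
    by (auto simp: step_def eval_Comp_iff list_all2_Cons1 eval_Proj_iff check)
  have "eval ?N (PrimRec Zero step) [n, string_code \<sigma>] y \<longleftrightarrow> y = 0 \<and> (n, \<sigma>) \<in> W" for n \<sigma> y
    by (induction n arbitrary: y)
      (auto simp: W_def eval_PrimRec_0_iff eval_PrimRec_Suc_iff eval_Zero_iff step less_Suc_eq)
  then have "ce_pairs W"
    unfolding ce_pairs_def by (intro exI[of _ "PrimRec Zero step"]) auto
  moreover have "correct_upto p q e n = {Y. \<exists>\<sigma>. (n, \<sigma>) \<in> W \<and> initial_segment \<sigma> Y}" (is "_ = ?U") for n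
  proof (intro equalityI subsetI)
    fix Y assume "Y \<in> correct_upto p q e n"
    then have Y: "eval (\<lambda>i. Y (p i)) e [k] (of_bool (Y (q k)))" if "k < n" for k
      using that by (simp add: correct_upto_def)
    let ?s = "\<lambda>l. map Y [0..<l]"
    have bit: "\<forall>\<^sub>F l in sequentially. bit_or_0 (?s l) i = Suc (of_bool (Y i))" for i
      using eventually_gt_at_top[of i] by eventually_elim (simp add: bit_or_0_def)
    have "\<forall>\<^sub>F l in sequentially. eval ?N (Mu dp) [i, string_code (?s l)] (of_bool (Y (p i)))" for i
      using bit[of "p i"] by (simp add: query)
    from simulate_complete[OF this Y]
    have "\<forall>\<^sub>F l in sequentially. eval ?N sim [k, string_code (?s l)] (of_bool (Y (q k)))" if "k < n" for k
      using that by (simp add: sim_def)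
    \<comment> \<open>One sufficiently long initial segment settles the finitely many computations
      and target bits.\<close>
    then have "\<forall>\<^sub>F l in sequentially. \<forall>k\<in>{..<n}. eval ?N sim [k, string_code (?s l)] (of_bool (Y (q k)))
        \<and> bit_or_0 (?s l) (q k) = Suc (of_bool (Y (q k)))"
      using bit by (intro eventually_ball_finite ballI eventually_conj) (simp_all only: lessThan_iff finite_lessThan)
    then obtain l where "\<forall>k\<in>{..<n}. eval ?N sim [k, string_code (?s l)] (of_bool (Y (q k)))
        \<and> bit_or_0 (?s l) (q k) = Suc (of_bool (Y (q k)))"
      using eventually_happens' trivial_limit_sequentially by blast
    then have "(n, ?s l) \<in> W" by (auto simp: W_def)
    then show "Y \<in> ?U" using initial_segment_map by blast
  next
    fix Y assume "Y \<in> ?U"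
    then obtain \<sigma> where \<sigma>: "(n, \<sigma>) \<in> W" "initial_segment \<sigma> Y" by blast
    have bit: "z = of_bool (Y i)" if "bit_or_0 \<sigma> i = Suc z" for i z
      using that \<sigma>(2) by (auto simp: bit_or_0_def initial_segment_iff split: if_splits)
    have "eval (\<lambda>i. Y (p i)) e [k] (of_bool (Y (q k)))" if "k < n" for k
    proof -
      from \<sigma>(1) that obtain v where v: "eval ?N sim [k, string_code \<sigma>] v" "bit_or_0 \<sigma> (q k) = Suc v"
        by (auto simp: W_def)
      have "eval (\<lambda>i. Y (p i)) e [k] v"
        by (rule simulate_sound[where C = ?N and q = "Mu dp" and s = "string_code \<sigma>"])
          (use v(1) in \<open>auto simp: query sim_def dest: bit\<close>)
      with bit[OF v(2)] show ?thesis by simp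
    qed
    then show "Y \<in> correct_upto p q e n" by (simp add: correct_upto_def)
  qed
  ultimately show ?thesis by blast
qed

text \<open>A computation of the bit at \<open>q n\<close> cannot consult that bit, as the ranges
  are disjoint. Flipping it keeps the first n answers correct and spoils the next, so each level has
  at most half the measure of the previous one.\<close>

lemma not_turing_le_disjoint_part:
  assumes "martin_lof_random Y"
    and p: "computable_from (\<lambda>_. False) (\<lambda>n. [n]) p"
    and q: "computable_from (\<lambda>_. False) (\<lambda>n. [n]) q"
    and "inj q" "range p \<inter> range q = {}"
  shows "\<not> turing_le (\<lambda>n. Y (q n)) (\<lambda>n. Y (p n))"
proof
  assume "turing_le (\<lambda>n. Y (q n)) (\<lambda>n. Y (p n))"
  then obtain e where e: "\<And>n. eval (\<lambda>n. Y (p n)) e [n] (of_bool (Y (q n)))"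
    unfolding turing_le_def by blast
  let ?S = "correct_upto p q e"
  obtain W where W: "ce_pairs W"
    "\<And>n. ?S n = {Y. \<exists>\<sigma>. (n, \<sigma>) \<in> W \<and> initial_segment \<sigma> Y}"
    using correct_upto_ce[OF p q] by blast
  have sets: "?S n \<in> sets cantor_measure" for n
  proof -
    have "?S n = (\<Union>\<sigma>\<in>{\<sigma>. (n, \<sigma>) \<in> W}. {Y. initial_segment \<sigma> Y})"
      unfolding W(2) by blast
    then show ?thesis by (auto intro!: sets.countable_UN' sets_initial_segment)
  qed
  have "emeasure cantor_measure (?S n) \<le> ennreal ((1 / 2) ^ n)" for n
  proof (induction n)
    case 0
    interpret prob_space cantor_measure
      unfolding cantor_measure_def by (intro prob_space_PiM prob_space_measure_pmf)
    show ?case using emeasure_le_1 by simp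
  next
    case (Suc n)
    \<comment> \<open>Disjoint ranges protect the oracle from the flip; injectivity of
      \<open>q\<close> protects the other target bits.\<close>
    have p_flip: "flip_bit (q n) Y (p i) = Y (p i)" for Y i
      using assms(5) by (auto simp: flip_bit_def)
    have q_flip: "flip_bit (q n) Y (q i) \<longleftrightarrow> (if i = n then \<not> Y (q i) else Y (q i))" for Y i
      using assms(4) by (auto simp: flip_bit_def inj_eq)
    have "2 * emeasure cantor_measure (?S (Suc n)) \<le> emeasure cantor_measure (?S n)"
    proof (rule emeasure_le_half_if_flip_disjoint[OF sets sets])
      show "?S (Suc n) \<inter> flip_bit (q n) -` ?S (Suc n) = {}"
      proof -
        \<comment> \<open>The oracles agree, so determinism forces equal outputs although the two
          target bits differ.\<close>
        have False if "Y \<in> ?S (Suc n)" "flip_bit (q n) Y \<in> ?S (Suc n)" for Y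
        proof -
          from that have "eval (\<lambda>i. Y (p i)) e [n] (of_bool (Y (q n)))"
            "eval (\<lambda>i. flip_bit (q n) Y (p i)) e [n] (of_bool (flip_bit (q n) Y (q n)))"
            unfolding correct_upto_def by blast+
          note this[unfolded p_flip q_flip]
          from eval_deterministic[OF this] show False by (cases "Y (q n)") simp_all
        qed
        then show ?thesis by auto
      qed
    qed (auto simp: correct_upto_def p_flip q_flip)
    also note Suc.IH
    finally have "2 * emeasure cantor_measure (?S (Suc n)) \<le> ennreal ((1 / 2) ^ n)" .
    also have "\<dots> = 2 * ennreal ((1 / 2) ^ Suc n)"
      by (subst ennreal_numeral[symmetric], subst ennreal_mult[symmetric]) auto
    finally show ?case by (subst (asm) ennreal_mult_le_mult_iff) auto
  qed
  then have "martin_lof_test ?S"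
    unfolding martin_lof_test_def using W by blast
  moreover have "Y \<in> (\<Inter>n. ?S n)" using e by (simp add: correct_upto_def)
  ultimately show False using assms(1) unfolding martin_lof_random_def by blast
qed

section \<open>Strong minimal covers and the halves of a random path\<close>

theorem theorem7p10:
  fixes a :: turing_degree
  assumes "\<exists>x. strong_minimal_cover x a"
  shows "\<not> (\<exists>T. perfect_tree T \<and> degree_computes a T \<and> (\<forall>X. martin_lof_random (tree_path T X)))"
proof
  assume "\<exists>T. perfect_tree T \<and> degree_computes a T \<and> (\<forall>X. martin_lof_random (tree_path T X))"
  then obtain T where T: "perfect_tree T" "degree_computes a T"
    and random: "\<And>X. martin_lof_random (tree_path T X)" by blast
  obtain x where x: "strong_minimal_cover x a" using assms by blast
  obtain A where A: "a = abs_turing_degree A" by (metis Quotient_turing_degree Quotient_abs_rep)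
  obtain X where X: "x = abs_turing_degree X" by (metis Quotient_turing_degree Quotient_abs_rep)
  have AX: "turing_le A X" "\<not> turing_le X A"
    and cover: "\<And>B. turing_le B X \<Longrightarrow> \<not> turing_le X B \<Longrightarrow> turing_le B A"
    using x unfolding strong_minimal_cover_def less_turing_degree_def A X
    by (metis less_eq_turing_degree.abs_eq)+
  have T_A: "computable_from A (\<lambda>\<sigma>. [string_code \<sigma>]) (\<lambda>\<sigma>. string_code (T \<sigma>))"
    using T(2) unfolding A computable_from_def by (simp add: degree_computes.abs_eq)
  have T_X: "computable_from X (\<lambda>\<sigma>. [string_code \<sigma>]) (\<lambda>\<sigma>. string_code (T \<sigma>))"
    using T_A AX(1) eval_replace_query unfolding computable_from_def turing_le_def by blast
  define R where "R = tree_path T X"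
  have R_X: "turing_le R X"
    unfolding R_def by (rule tree_path_le[OF T(1) T_X turing_le_refl])
  have R_A: "\<not> turing_le R A"
    unfolding R_def using le_tree_path[OF T(1) T_A] AX(2) by blast
  have X_R: "turing_le X R" using cover[OF R_X] R_A by blast
  let ?p = "\<lambda>n::nat. 2 * n" and ?q = "\<lambda>n::nat. 2 * n + 1"
  have comp: "computable_from B (\<lambda>n. [n]) ?p" "computable_from B (\<lambda>n. [n]) ?q" for B
    by (intro computable_arith)+
  \<comment> \<open>Stated for either assignment of even and odd bits, since the two halves play
    symmetric roles.\<close>
  have half: "turing_le (\<lambda>n. R (p n)) A"
    if p: "p = ?p \<and> q = ?q \<or> p = ?q \<and> q = ?p" for p q
  proof -
    have pq: "computable_from B (\<lambda>n. [n]) p" "computable_from B (\<lambda>n. [n]) q" for B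
      using p comp by auto
    have le: "turing_le (\<lambda>n. R (r n)) R" if "\<And>B. computable_from B (\<lambda>n. [n]) r" for r
      using computable_comp[of R "\<lambda>n. n" "\<lambda>n. of_bool (R n)" "\<lambda>n. [n]" r] that turing_le_refl[of R]
      by (simp add: turing_le_iff_computable)
    have "inj q" "range p \<inter> range q = {}"
      using p by (auto simp: inj_def) presburger+
    then have "\<not> turing_le (\<lambda>n. R (q n)) (\<lambda>n. R (p n))"
      using not_turing_le_disjoint_part[OF random pq] unfolding R_def by blast
    \<comment> \<open>Otherwise the \<open>q\<close> half would be computable from \<open>R\<close>,
      hence from \<open>X\<close>, hence from the \<open>p\<close> half. So the \<open>p\<close>
      half lies strictly below \<open>X\<close>, and the cover property applies.\<close>
    then have "\<not> turing_le X (\<lambda>n. R (p n))"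
      using le[OF pq(2)] R_X turing_le_trans by blast
    with cover le[OF pq(1)] R_X turing_le_trans show ?thesis by blast
  qed
  have "turing_le R A"
    by (rule turing_le_even_odd) (rule half[of ?p ?q] half[of ?q ?p], simp)+
  with R_A show False ..
qed

end
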